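(* Let two parabolas in the Euclidean plane meet in four distinct points that lie on one circle. Then the intersection point of the axes of these parabolas coincides with the barycentre (centre of mass, with equal weights) of these four points.
   Context: The axis of a parabola is its line of symmetry. *)

theory Defs
  imports "HOL-Analysis.Analysis"
begin

definition is_line :: "(real^2) set \<Rightarrow> bool" where
  "is_line L \<longleftrightarrow> affine L \<and> aff_dim L = 1"

definition is_parabola :: "(real^2) set \<Rightarrow> bool" where
  "is_parabola P \<longleftrightarrow>
     (\<exists>F D. is_line D \<and> F \<notin> D \<and> P = {X. dist X F = infdist X D})"

(* On a line L the point closest_point L X is the foot of the perpendicular from X,
   i.e. the midpoint of X and its mirror image. *)
definition reflection :: "(real^2) set \<Rightarrow> real^2 \<Rightarrow> real^2" where
  "reflection L X = 2 *\<^sub>R closest_point L X - X"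

definition line_of_symmetry :: "(real^2) set \<Rightarrow> (real^2) set \<Rightarrow> bool" where
  "line_of_symmetry L P \<longleftrightarrow> is_line L \<and> reflection L ` P = P"

(* A parabola has exactly one line of symmetry, so the description is proper there. *)
definition parabola_axis :: "(real^2) set \<Rightarrow> (real^2) set" where
  "parabola_axis P = (THE L. line_of_symmetry L P)"

end

(* In a frame (u, v) centred at its vertex V, a parabola is s^2 = k t.  Substituting t = s^2 / k into
   the equation of a circle gives a quartic in s without cubic term, so by Vieta the s-coordinates
   of four concyclic points of the parabola sum to 0: their barycentre lies on the axis s = 0.
   Hence it lies on both axes.  If these were parallel they would coincide, and coaxial parabolas
   through four (even three) distinct common points are equal, contradicting a finite intersection. *)
theory Submission
  imports Defs
begin

section \<open>Lines in the plane: unit normals, distance and reflection\<close>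

lemma is_line_iff_unit_normal:
  "is_line L \<longleftrightarrow> (\<exists>n c. norm n = 1 \<and> L = {X. n \<bullet> X = c})"
proof
  assume "is_line L"
  then have aff: "affine L" and dim: "aff_dim L = 1"
    by (auto simp: is_line_def)
  have "\<exists>a b. a \<noteq> 0 \<and> affine hull L = {x. a \<bullet> x = b}"
    using aff_dim_eq_hyperplane[of L] dim by simp
  then obtain a b where a: "a \<noteq> 0" and "affine hull L = {x. a \<bullet> x = b}"
    by blast
  then have L: "L = {x. a \<bullet> x = b}"
    using aff affine_hull_eq by metis
  have "(a /\<^sub>R norm a) \<bullet> x = b / norm a \<longleftrightarrow> a \<bullet> x = b" for x
    using a by (simp add: divide_inverse_commute)
  then have "L = {x. (a /\<^sub>R norm a) \<bullet> x = b / norm a}"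
    by (simp only: L)
  moreover have "norm (a /\<^sub>R norm a) = 1"
    using a by simp
  ultimately show "\<exists>n c. norm n = 1 \<and> L = {X. n \<bullet> X = c}"
    by blast
next
  assume "\<exists>n c. norm n = 1 \<and> L = {X. n \<bullet> X = c}"
  then obtain n c where "norm n = 1" and L: "L = {X. n \<bullet> X = c}"
    by blast
  then have "n \<noteq> 0"
    by auto
  then show "is_line L"
    by (simp add: is_line_def L affine_hyperplane)
qed

text \<open>By Cauchy-Schwarz against the unit normal, every \<open>Y\<close> of the hyperplane has
  distance at least \<open>\<bar>n \<bullet> X - c\<bar>\<close> from \<open>X\<close>, and the
  displayed point attains this bound.\<close>

lemma closest_point_hyperplane:
  fixes n :: "'a::euclidean_space"
  assumes "norm n = 1"
  shows "closest_point {Y. n \<bullet> Y = c} X = X - (n \<bullet> X - c) *\<^sub>R n"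
proof (rule closest_point_unique[symmetric])
  have nn: "n \<bullet> n = 1"
    using assms by (simp add: norm_eq_1)
  show "convex {Y. n \<bullet> Y = c}" "closed {Y. n \<bullet> Y = c}"
    by (auto simp: convex_hyperplane closed_hyperplane)
  show "X - (n \<bullet> X - c) *\<^sub>R n \<in> {Y. n \<bullet> Y = c}"
    by (simp add: inner_diff_right nn)
  show "\<forall>Y\<in>{Y. n \<bullet> Y = c}. dist X (X - (n \<bullet> X - c) *\<^sub>R n) \<le> dist X Y"
  proof
    fix Y assume "Y \<in> {Y. n \<bullet> Y = c}"
    then have "\<bar>n \<bullet> X - c\<bar> = \<bar>n \<bullet> (X - Y)\<bar>"
      by (simp add: inner_diff_right)
    also have "\<dots> \<le> norm n * norm (X - Y)"
      by (rule Cauchy_Schwarz_ineq2)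
    finally show "dist X (X - (n \<bullet> X - c) *\<^sub>R n) \<le> dist X Y"
      using assms by (simp add: dist_norm)
  qed
qed

lemma infdist_hyperplane:
  fixes n :: "'a::euclidean_space"
  assumes "norm n = 1"
  shows "infdist X {Y. n \<bullet> Y = c} = \<bar>n \<bullet> X - c\<bar>"
proof -
  have nn: "n \<bullet> n = 1"
    using assms by (simp add: norm_eq_1)
  have "c *\<^sub>R n \<in> {Y. n \<bullet> Y = c}"
    by (simp add: nn)
  then have ne: "{Y. n \<bullet> Y = c} \<noteq> {}"
    by blast
  have "infdist X {Y. n \<bullet> Y = c} = dist X (closest_point {Y. n \<bullet> Y = c} X)"
    using setdist_closest_point[OF closed_hyperplane ne, of X] by (simp add: infdist_eq_setdist)
  also have "\<dots> = \<bar>n \<bullet> X - c\<bar>"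
    using assms by (simp add: closest_point_hyperplane dist_norm)
  finally show ?thesis .
qed

lemma reflection_hyperplane:
  assumes "norm n = 1"
  shows "reflection {Y. n \<bullet> Y = c} X = X - (2 * (n \<bullet> X - c)) *\<^sub>R n"
  unfolding reflection_def closest_point_hyperplane[OF assms]
  by (simp add: algebra_simps scaleR_2)

section \<open>The root sum of a quartic without cubic term\<close>

text \<open>Vieta by repeated divided differences: each new distinct root lets one linear factor be
  cancelled, until only \<open>A\<close> times the root sum is left.\<close>

lemma quartic_distinct_roots_sum:
  fixes a b c d :: real
  assumes root: "\<And>s. s \<in> {a, b, c, d} \<Longrightarrow> A * s^4 + B * s^2 + C * s + D = 0"
    and "distinct [a, b, c, d]" and "A \<noteq> 0"
  shows "a + b + c + d = 0"
proof -
  \<comment> \<open>The first divided difference of the quartic at \<open>a\<close> and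
    \<open>x\<close>; \<open>div2\<close> is the second one, at \<open>a\<close>, \<open>b\<close>
    and \<open>x\<close>.\<close>
  have div1: "A * (a^3 + a^2 * x + a * x^2 + x^3) + B * (a + x) + C = 0"
    if "x \<in> {b, c, d}" for x
  proof -
    have "(x - a) * (A * (a^3 + a^2 * x + a * x^2 + x^3) + B * (a + x) + C) = 0"
      using root[of a] root[of x] that by (simp; algebra)
    then show ?thesis
      using that assms(2) by auto
  qed
  have div2: "A * (a^2 + b^2 + x^2 + a * b + a * x + b * x) + B = 0" if "x \<in> {c, d}" for x
  proof -
    have "(x - b) * (A * (a^2 + b^2 + x^2 + a * b + a * x + b * x) + B) = 0"
      using div1[of b] div1[of x] that by (simp; algebra)
    then show ?thesis
      using that assms(2) by auto
  qed
  have "(d - c) * (A * (a + b + c + d)) = 0"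
    using div2[of c] div2[of d] by (simp; algebra)
  then show ?thesis
    using assms(2,3) by auto
qed

section \<open>A parabola in an orthonormal frame at its vertex\<close>

text \<open>\<open>V\<close> is the vertex, \<open>u\<close> the direction of the tangent there and
  \<open>v\<close> that of the axis. The sign of \<open>k\<close> is free, so \<open>v\<close> may
  point to either side.\<close>

locale parabola_frame =
  fixes V u v :: "real^2" and k :: real and P :: "(real^2) set"
  assumes unit: "norm u = 1" "norm v = 1" and ortho: "u \<bullet> v = 0"
    and k_nonzero: "k \<noteq> 0"
    and P_eq: "P = {X. (u \<bullet> (X - V))\<^sup>2 = k * (v \<bullet> (X - V))}"
begin

lemma frame_inner: "u \<bullet> u = 1" "v \<bullet> v = 1" "u \<bullet> v = 0" "v \<bullet> u = 0"
  using unit ortho by (auto simp: norm_eq_1 inner_commute)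

lemma frame_decomp: "x = (u \<bullet> x) *\<^sub>R u + (v \<bullet> x) *\<^sub>R v"
proof -
  have 1: "u$1 * u$1 + u$2 * u$2 = 1" "v$1 * v$1 + v$2 * v$2 = 1" "u$1 * v$1 + u$2 * v$2 = 0"
    using frame_inner by (simp_all add: inner_vec_def sum_2)
  \<comment> \<open>The matrix with rows \<open>u\<close> and \<open>v\<close> is orthogonal, so its
    columns are orthonormal as well.\<close>
  have 2: "u$1 * u$1 + v$1 * v$1 = 1" "u$2 * u$2 + v$2 * v$2 = 1" "u$1 * u$2 + v$1 * v$2 = 0"
    using 1 by algebra+
  show ?thesis
    unfolding vec_eq_iff forall_2 using 2
    by (simp add: inner_vec_def sum_2; algebra)
qed

lemma inner_frame: "x \<bullet> y = (u \<bullet> x) * (u \<bullet> y) + (v \<bullet> x) * (v \<bullet> y)"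
proof -
  have "x \<bullet> y = ((u \<bullet> x) *\<^sub>R u + (v \<bullet> x) *\<^sub>R v) \<bullet> y"
    using frame_decomp[of x] by simp
  then show ?thesis
    by (simp add: inner_add_left)
qed

text \<open>The parabola is the graph t = s^2 / k over its vertex tangent, so the coordinate s along
  \<open>u\<close> parametrises it.\<close>

definition point :: "real \<Rightarrow> real^2" where
  "point s = V + s *\<^sub>R u + (s\<^sup>2 / k) *\<^sub>R v"

lemma frame_point [simp]: "u \<bullet> (point s - V) = s" "v \<bullet> (point s - V) = s\<^sup>2 / k"
  by (simp_all add: point_def inner_add_right frame_inner)

lemma point_in: "point s \<in> P"
  using k_nonzero by (simp add: P_eq)

lemma eq_point:
  assumes "X \<in> P"
  shows "X = point (u \<bullet> (X - V))"
proof -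
  have "(u \<bullet> (X - V))\<^sup>2 / k = v \<bullet> (X - V)"
    using assms k_nonzero by (simp add: P_eq)
  then have "point (u \<bullet> (X - V)) = V + ((u \<bullet> (X - V)) *\<^sub>R u + (v \<bullet> (X - V)) *\<^sub>R v)"
    by (simp add: point_def add.assoc)
  also have "\<dots> = V + (X - V)"
    using frame_decomp[of "X - V"] by (rule arg_cong[OF sym])
  finally show ?thesis
    by simp
qed

lemma infinite_parabola: "infinite P"
proof -
  have "inj point"
    by (metis injI frame_point(1))
  then have "infinite (range point)"
    using finite_imageD infinite_UNIV_char_0 by blast
  moreover have "range point \<subseteq> P"
    using point_in by auto
  ultimately show ?thesis
    by (rule infinite_super[rotated])
qed

lemma line_of_symmetry_axis: "line_of_symmetry {X. u \<bullet> X = u \<bullet> V} P"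
proof -
  let ?R = "reflection {X. u \<bullet> X = u \<bullet> V}"
  have R: "?R X = X - (2 * (u \<bullet> (X - V))) *\<^sub>R u" for X
    by (simp add: reflection_hyperplane unit inner_diff_right)
  have uv: "u \<bullet> (?R X - V) = - (u \<bullet> (X - V))" "v \<bullet> (?R X - V) = v \<bullet> (X - V)" for X
    by (simp_all add: R inner_diff_right frame_inner)
  have "?R X \<in> P" if "X \<in> P" for X
    using that by (simp only: P_eq mem_Collect_eq uv power2_minus)
  \<comment> \<open>Being an involution turns the inclusion of the image in \<open>P\<close> into
    equality.\<close>
  moreover have "?R (?R X) = X" for X
    by (simp add: R[of "?R X"] uv) (simp add: R)
  ultimately have "?R ` P = P"
    by (intro subset_antisym image_subsetI subsetI image_eqI[of _ ?R "?R _"]) simp_all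
  then show ?thesis
    unfolding line_of_symmetry_def is_line_iff_unit_normal using unit(1) by blast
qed

text \<open>Reflecting every \<open>point s\<close> in \<open>L\<close> must give points of
  \<open>P\<close>. This is a polynomial identity in s, and its coefficients force the normal of
  \<open>L\<close> to be parallel to \<open>u\<close> and \<open>L\<close> to pass through
  \<open>V\<close>.\<close>

lemma line_of_symmetry_unique:
  assumes "line_of_symmetry L P"
  shows "L = {X. u \<bullet> X = u \<bullet> V}"
proof -
  obtain n c where n: "norm n = 1" and L: "L = {X. n \<bullet> X = c}"
    using assms by (auto simp: line_of_symmetry_def is_line_iff_unit_normal)
  define \<alpha> \<beta> e where "\<alpha> = u \<bullet> n" and "\<beta> = v \<bullet> n" and "e = c - n \<bullet> V"
  have unit_n: "\<alpha>\<^sup>2 + \<beta>\<^sup>2 = 1"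
    using n inner_frame[of n n] by (simp add: \<alpha>_def \<beta>_def norm_eq_1 power2_eq_square)
  \<comment> \<open>The first factor is the signed distance of \<open>point s\<close> from
    \<open>L\<close>, zero where the reflection fixes the point; the second carries the condition at
    all other points.\<close>
  have prod0: "(\<alpha> * s + \<beta> * s\<^sup>2 / k - e) * (\<alpha>\<^sup>2 * (\<alpha> * s + \<beta> * s\<^sup>2 / k - e) - \<alpha> * s + k * \<beta> / 2) = 0"
    for s
  proof -
    let ?h = "\<alpha> * s + \<beta> * s\<^sup>2 / k - e"
    have "n \<bullet> (point s - V) = \<alpha> * s + \<beta> * s\<^sup>2 / k"
      using inner_frame[of n "point s - V"] by (simp add: \<alpha>_def \<beta>_def)
    then have "n \<bullet> point s - c = ?h"
      by (simp add: e_def inner_diff_right)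
    then have R: "reflection L (point s) = point s - (2 * ?h) *\<^sub>R n"
      by (simp add: L reflection_hyperplane n)
    have "reflection L (point s) \<in> P"
      using assms point_in unfolding line_of_symmetry_def by blast
    then have "(u \<bullet> (point s - (2 * ?h) *\<^sub>R n - V))\<^sup>2 = k * (v \<bullet> (point s - (2 * ?h) *\<^sub>R n - V))"
      by (simp add: P_eq R)
    moreover have "u \<bullet> (point s - (2 * ?h) *\<^sub>R n - V) = s - 2 * ?h * \<alpha>"
      using frame_point(1)[of s] by (simp add: \<alpha>_def inner_diff_right)
    moreover have "v \<bullet> (point s - (2 * ?h) *\<^sub>R n - V) = s\<^sup>2 / k - 2 * ?h * \<beta>"
      using frame_point(2)[of s] by (simp add: \<beta>_def inner_diff_right)
    ultimately have "(s - 2 * ?h * \<alpha>)\<^sup>2 = s\<^sup>2 - 2 * k * ?h * \<beta>"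
      using k_nonzero by (simp add: right_diff_distrib)
    moreover have "(s - 2 * h * \<alpha>)\<^sup>2 = s\<^sup>2 - 2 * k * h * \<beta> \<Longrightarrow>
        h * (\<alpha>\<^sup>2 * h - \<alpha> * s + k * \<beta> / 2) = 0" for h
      by (simp add: power2_eq_square algebra_simps)
    ultimately show ?thesis
      by blast
  qed
  \<comment> \<open>The two factors as polynomials in s: since their product vanishes identically,
    one of them is the zero polynomial.\<close>
  define p q where "p = [:- e, \<alpha>, \<beta> / k:]"
    and "q = [:k * \<beta> / 2 - \<alpha>\<^sup>2 * e, \<alpha>^3 - \<alpha>, \<alpha>\<^sup>2 * \<beta> / k:]"
  have "poly p s = \<alpha> * s + \<beta> * s\<^sup>2 / k - e"
    and "poly q s = \<alpha>\<^sup>2 * (\<alpha> * s + \<beta> * s\<^sup>2 / k - e) - \<alpha> * s + k * \<beta> / 2" for s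
    by (simp_all add: p_def q_def algebra_simps power2_eq_square power3_eq_cube)
  then have "poly (p * q) s = 0" for s
    using prod0[of s] by (simp only: poly_mult)
  then have "p * q = 0"
    using poly_all_0_iff_0 by blast
  moreover have "p \<noteq> 0"
    using unit_n k_nonzero by (auto simp: p_def)
  ultimately have "q = 0"
    by simp
  then have q: "k * \<beta> / 2 = \<alpha>\<^sup>2 * e" "\<alpha>\<^sup>2 * \<beta> = 0"
    using k_nonzero by (auto simp: q_def)
  \<comment> \<open>With \<alpha> = 0 the first equation would give \<beta> = 0, against
    \<open>unit_n\<close>.\<close>
  have "\<alpha> \<noteq> 0"
    using q unit_n k_nonzero by auto
  then have "\<beta> = 0" "e = 0"
    using q by auto
  have "n = \<alpha> *\<^sub>R u"
    using frame_decomp[of n] \<open>\<beta> = 0\<close> by (simp add: \<alpha>_def \<beta>_def)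
  then show ?thesis
    using \<open>\<alpha> \<noteq> 0\<close> \<open>e = 0\<close> by (auto simp: L e_def)
qed

lemma parabola_axis_eq: "parabola_axis P = {X. u \<bullet> X = u \<bullet> V}"
  unfolding parabola_axis_def
  using line_of_symmetry_axis line_of_symmetry_unique by (rule the_equality)

lemma distinct_coordinates:
  assumes "X \<in> P" "Y \<in> P" "X \<noteq> Y"
  shows "u \<bullet> (X - V) \<noteq> u \<bullet> (Y - V)"
  using assms eq_point by metis

lemma concyclic_barycentre_on_axis:
  assumes "distinct [a, b, c, d]" and "{a, b, c, d} \<subseteq> P" and "{a, b, c, d} \<subseteq> sphere z r"
  shows "(1/4) *\<^sub>R (a + b + c + d) \<in> parabola_axis P"
proof -
  \<comment> \<open>With \<open>?w\<close> the centre seen from \<open>V\<close>, the circle reads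
    s^2 + t^2 - 2 (s (u \<bullet> w) + t (v \<bullet> w)) + w \<bullet> w = r^2. Putting t = s^2 / k
    produces only powers 4, 2, 1 and 0 of s.\<close>
  let ?s = "\<lambda>X. u \<bullet> (X - V)"
  let ?w = "z - V"
  have "(1 / k\<^sup>2) * (?s X)^4 + (1 - 2 * (v \<bullet> ?w) / k) * (?s X)\<^sup>2
      + (- 2 * (u \<bullet> ?w)) * ?s X + (?w \<bullet> ?w - r\<^sup>2) = 0"
    if "X \<in> {a, b, c, d}" for X
  proof -
    have t: "v \<bullet> (X - V) = (?s X)\<^sup>2 / k"
      using that assms(2) k_nonzero by (auto simp: P_eq)
    have "norm ((X - V) - ?w) = r"
      using that assms(3) by (auto simp: dist_norm norm_minus_commute)
    then have "((X - V) - ?w) \<bullet> ((X - V) - ?w) = r\<^sup>2"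
      by (metis power2_norm_eq_inner)
    then have "(X - V) \<bullet> (X - V) - 2 * ((X - V) \<bullet> ?w) + ?w \<bullet> ?w = r\<^sup>2"
      unfolding inner_diff_left[of "X - V" ?w] inner_diff_right[of _ "X - V" ?w]
      using inner_commute[of "X - V" ?w] by linarith
    then have "(?s X)\<^sup>2 + ((?s X)\<^sup>2 / k)\<^sup>2 - 2 * (?s X * (u \<bullet> ?w) + (?s X)\<^sup>2 / k * (v \<bullet> ?w))
        + ?w \<bullet> ?w = r\<^sup>2"
      unfolding inner_frame[of "X - V"] t by (simp only: power2_eq_square)
    then show ?thesis
      by (simp add: power_divide algebra_simps flip: power_mult)
  qed
  then have root: "(1 / k\<^sup>2) * s^4 + (1 - 2 * (v \<bullet> ?w) / k) * s\<^sup>2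
      + (- 2 * (u \<bullet> ?w)) * s + (?w \<bullet> ?w - r\<^sup>2) = 0"
    if "s \<in> {?s a, ?s b, ?s c, ?s d}" for s
    using that by blast
  have "distinct [?s a, ?s b, ?s c, ?s d]"
    using assms(1,2) distinct_coordinates by auto
  moreover have "1 / k\<^sup>2 \<noteq> 0"
    using k_nonzero by simp
  ultimately have "?s a + ?s b + ?s c + ?s d = 0"
    using quartic_distinct_roots_sum[OF root] by blast
  then show ?thesis
    by (simp add: parabola_axis_eq inner_diff_right inner_add_right)
qed

end

section \<open>From focus and directrix to the vertex frame\<close>

text \<open>Squaring the focus-directrix condition gives s^2 + (t - k/2)^2 = (t + k/2)^2, where the
  squares of t cancel.\<close>

lemma is_parabola_imp_frame:
  assumes "is_parabola P"
  obtains V u v k where "parabola_frame V u v k P"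
proof -
  obtain F D where D: "is_line D" "F \<notin> D" and P: "P = {X. dist X F = infdist X D}"
    using assms by (auto simp: is_parabola_def)
  obtain v c where v: "norm v = 1" and Deq: "D = {X. v \<bullet> X = c}"
    using D(1) is_line_iff_unit_normal by blast
  \<comment> \<open>\<open>k\<close> is the signed distance of the focus from the directrix,
    \<open>V\<close> the midpoint of the focus and its foot on the directrix, and \<open>u\<close>
    is \<open>v\<close> after a quarter turn.\<close>
  define k where "k = v \<bullet> F - c"
  define V where "V = F - (k / 2) *\<^sub>R v"
  define u :: "real^2" where "u = vector [- v$2, v$1]"
  have vv: "v \<bullet> v = 1"
    using v by (simp add: norm_eq_1)
  have uv: "norm u = 1" "u \<bullet> v = 0"
    using vv by (simp_all add: norm_eq_1 u_def inner_vec_def sum_2)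
  have k: "2 * k \<noteq> 0"
    using D(2) by (simp add: Deq k_def)
  interpret T: parabola_frame V u v "2 * k" "{X. (u \<bullet> (X - V))\<^sup>2 = (2 * k) * (v \<bullet> (X - V))}"
    using uv v k by unfold_locales auto
  have "X \<in> P \<longleftrightarrow> (u \<bullet> (X - V))\<^sup>2 = (2 * k) * (v \<bullet> (X - V))" for X
  proof -
    let ?s = "u \<bullet> (X - V)" and ?t = "v \<bullet> (X - V)"
    have F: "u \<bullet> (X - F) = ?s" "v \<bullet> (X - F) = ?t - k / 2" "v \<bullet> X - c = ?t + k / 2"
      using uv vv by (simp_all add: V_def k_def inner_diff_right)
    have "X \<in> P \<longleftrightarrow> norm (X - F) = \<bar>v \<bullet> X - c\<bar>"
      by (simp add: P Deq infdist_hyperplane[OF v] dist_norm)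
    also have "\<dots> \<longleftrightarrow> (X - F) \<bullet> (X - F) = (v \<bullet> X - c)\<^sup>2"
      by (simp add: norm_eq_square)
    also have "\<dots> \<longleftrightarrow> ?s\<^sup>2 + (?t - k / 2)\<^sup>2 = (?t + k / 2)\<^sup>2"
      by (simp only: T.inner_frame[of "X - F"] F power2_eq_square)
    also have "\<dots> \<longleftrightarrow> ?s\<^sup>2 = (2 * k) * ?t"
      by (auto simp: power2_eq_square algebra_simps)
    finally show ?thesis .
  qed
  then have "P = {X. (u \<bullet> (X - V))\<^sup>2 = (2 * k) * (v \<bullet> (X - V))}"
    by blast
  then show ?thesis
    using T.parabola_frame_axioms that by metis
qed

section \<open>Coaxial parabolas with three common points\<close>

text \<open>The hypotheses on \<open>u'\<close> and \<open>V'\<close> say that the axes coincide. In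
  the frame of \<open>P\<close> the second parabola is then s^2 = \<kappa> (t - q), and eliminating
  t leaves an equation in s^2 alone.\<close>

lemma (in parabola_frame) coaxial_parabolas_eq:
  assumes "parabola_frame V' u' v' k' Q" and "u' \<bullet> v = 0" and "u \<bullet> V' = u \<bullet> V"
    and "distinct [a, b, c]" and "{a, b, c} \<subseteq> P \<inter> Q"
  shows "P = Q"
proof -
  interpret Q: parabola_frame V' u' v' k' Q
    by fact
  \<comment> \<open>The frames agree up to orientation: \<epsilon> and \<delta> are the signs
    relating their vectors, and \<open>q\<close> is the shift of the vertex along the axis.\<close>
  define \<epsilon> \<delta> q where "\<epsilon> = u \<bullet> u'" and "\<delta> = v \<bullet> v'" and "q = v \<bullet> (V' - V)"
  have u': "u' = \<epsilon> *\<^sub>R u"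
    using frame_decomp[of u'] assms(2) by (simp add: \<epsilon>_def inner_commute)
  then have \<epsilon>: "\<epsilon>\<^sup>2 = 1"
    using Q.frame_inner(1) by (simp add: frame_inner power2_eq_square)
  have "u \<bullet> v' = 0"
    using Q.frame_inner(3) \<epsilon> by (auto simp: u')
  then have v': "v' = \<delta> *\<^sub>R v"
    using frame_decomp[of v'] by (simp add: \<delta>_def)
  then have \<delta>: "\<delta> \<noteq> 0"
    using Q.frame_inner(2) by auto
  define \<kappa> where "\<kappa> = k' * \<delta>"
  have \<kappa>: "\<kappa> \<noteq> 0"
    using \<delta> Q.k_nonzero by (simp add: \<kappa>_def)
  have Q: "X \<in> Q \<longleftrightarrow> (u \<bullet> (X - V))\<^sup>2 = \<kappa> * (v \<bullet> (X - V) - q)" for X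
  proof -
    have "u' \<bullet> (X - V') = \<epsilon> * (u \<bullet> (X - V))" "v' \<bullet> (X - V') = \<delta> * (v \<bullet> (X - V) - q)"
      using assms(3) by (simp_all add: u' v' q_def inner_diff_right right_diff_distrib)
    then show ?thesis
      using \<epsilon> by (simp add: Q.P_eq \<kappa>_def power_mult_distrib mult.assoc)
  qed
  let ?s = "\<lambda>X. u \<bullet> (X - V)"
  have eq: "(k - \<kappa>) * (?s X)\<^sup>2 = - k * \<kappa> * q" if "X \<in> {a, b, c}" for X
  proof -
    have "(?s X)\<^sup>2 = k * (v \<bullet> (X - V))" "(?s X)\<^sup>2 = \<kappa> * (v \<bullet> (X - V) - q)"
      using that assms(5) Q by (auto simp: P_eq)
    then show ?thesis
      by algebra
  qed
  have s: "?s a \<noteq> ?s b" "?s a \<noteq> ?s c" "?s b \<noteq> ?s c"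
    using assms(4,5) distinct_coordinates by auto
  have "k = \<kappa>"
  proof (rule ccontr)
    assume "k \<noteq> \<kappa>"
    \<comment> \<open>Three distinct reals cannot share one square.\<close>
    then have "(?s a)\<^sup>2 = (?s b)\<^sup>2" "(?s a)\<^sup>2 = (?s c)\<^sup>2"
      using eq[of a] eq[of b] eq[of c] by (metis insertCI mult_left_cancel right_minus_eq)+
    then show False
      using s by (auto simp: power2_eq_iff)
  qed
  moreover have "q = 0"
    using eq[of a] calculation k_nonzero \<kappa> by simp
  ultimately show "P = Q"
    using Q by (auto simp: P_eq)
qed

section \<open>The common point of the two axes\<close>

theorem mainTheorem5:
  fixes P Q :: "(real^2) set" and a b c d z :: "real^2" and r :: real
  assumes "is_parabola P" and "is_parabola Q"
    and "distinct [a, b, c, d]"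
    and "P \<inter> Q = {a, b, c, d}"
    and "r > 0" and "{a, b, c, d} \<subseteq> sphere z r"
  shows "parabola_axis P \<inter> parabola_axis Q = {(1/4) *\<^sub>R (a + b + c + d)}"
proof -
  let ?G = "(1/4) *\<^sub>R (a + b + c + d)"
  obtain V u v k where "parabola_frame V u v k P"
    using assms(1) is_parabola_imp_frame by blast
  then interpret P: parabola_frame V u v k P .
  obtain V' u' v' k' where Q: "parabola_frame V' u' v' k' Q"
    using assms(2) is_parabola_imp_frame by blast
  then interpret Q: parabola_frame V' u' v' k' Q .
  have G: "?G \<in> parabola_axis P" "?G \<in> parabola_axis Q"
    using assms(3,4,6) by (intro P.concyclic_barycentre_on_axis Q.concyclic_barycentre_on_axis; blast)+
  have not_parallel: "u' \<bullet> v \<noteq> 0"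
  proof
    assume "u' \<bullet> v = 0"
    then have "u' = (u \<bullet> u') *\<^sub>R u"
      using P.frame_decomp[of u'] by (simp add: inner_commute)
    then obtain \<epsilon> where u': "u' = \<epsilon> *\<^sub>R u" "\<epsilon> \<noteq> 0"
      using Q.unit(1) by (metis norm_zero scaleR_zero_left zero_neq_one)
    \<comment> \<open>Parallel axes through the same point \<open>?G\<close> coincide, so the vertex
      of \<open>Q\<close> lies on the axis of \<open>P\<close>.\<close>
    have "u \<bullet> V' = u \<bullet> ?G"
      using G(2) u' by (simp add: Q.parabola_axis_eq)
    also have "\<dots> = u \<bullet> V"
      using G(1) unfolding P.parabola_axis_eq by simp
    finally have "P = Q"
      using \<open>u' \<bullet> v = 0\<close> assms(3,4) by (intro P.coaxial_parabolas_eq[OF Q, of a b c]) auto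
    then show False
      using assms(4) P.infinite_parabola by simp
  qed
  have "Y = ?G" if "Y \<in> parabola_axis P" "Y \<in> parabola_axis Q" for Y
  proof -
    have "u \<bullet> (Y - ?G) = 0" "u' \<bullet> (Y - ?G) = 0"
      using that G unfolding P.parabola_axis_eq Q.parabola_axis_eq mem_Collect_eq
        inner_diff_right by linarith+
    \<comment> \<open>Orthogonality to \<open>u\<close> leaves only a multiple of \<open>v\<close>;
      orthogonality to \<open>u'\<close> then makes it zero because \<open>u' \<bullet> v\<close> is
      not.\<close>
    moreover from this have "Y - ?G = (v \<bullet> (Y - ?G)) *\<^sub>R v"
      using P.frame_decomp[of "Y - ?G"] by simp
    ultimately have "(v \<bullet> (Y - ?G)) * (u' \<bullet> v) = 0"
      by (metis inner_scaleR_right)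
    then have "v \<bullet> (Y - ?G) = 0"
      using not_parallel by simp
    then have "Y - ?G = 0"
      using \<open>Y - ?G = _\<close> by simp
    then show ?thesis
      by simp
  qed
  then show ?thesis
    using G by blast
qed

end
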